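(* Let $\mathcal{M}\subseteq\mathbb{R}^d$ be a compact embedded $C^2$-submanifold without boundary with reach $\tau_{\mathcal{M}}>0$, let $\mu$ be a Borel probability measure supported on $\mathcal{M}$, $f\in C^1(\mathbb{R}^d)$, $C=\sup_{\mathcal{T}(\tau_{\mathcal{M}})}\|\nabla f\|$, and $\eta>0$. Let $\tau\in(0,\tau_{\mathcal{M}}/2)$ and $\sigma>0$ be such that for some $\epsilon\in\big(0,\frac{\eta\tau}{2(C+\eta)}\big]$, $$\|\pi_\sigma(x)-\pi(x)\|<\epsilon,\qquad\|P_\sigma(x)-P_0(x)\|<\epsilon\qquad\text{for all }x\in\mathcal{T}(\tau).$$ Let $$\gamma_{\mathrm{tubular}}(\epsilon,\tau,\eta)=\tau\cdot\min\Big\{\frac{1}{2(C(\epsilon+2)+2\eta\tau)},\ \frac{\frac14\eta\tau-\frac12(C+\eta)\epsilon}{4(C(\epsilon+4)+3\eta\tau)^2}\Big\}.$$ If $\gamma_k\in[0,\gamma_{\mathrm{tubular}}]$ for all $k$ and $x_0\in\mathcal{T}(\tau)$, then all iterates of $x_{k+1}=x_k-\gamma_k\nabla F_\sigma^\eta(x_k)$ belong to $\mathcal{T}(\tau)$.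
   Context: Reach $\tau_{\mathcal{M}}$: largest $\tau\ge0$ such that $(p,v)\mapsto p+v$ on $\{(p,v):p\in\mathcal{M},v\in N_p\mathcal{M},\|v\|<\tau\}$ is a diffeomorphism onto its image; $\mathcal{T}(\tau)=\{p+v:p\in\mathcal{M},v\in N_p\mathcal{M},\|v\|<\tau\}$; $\pi(x)$ is the unique closest point of $\mathcal{M}$ to $x$, $P_0(x)=\pi'(x)$ its Jacobian. With $p_\sigma$ the density of $\mathcal{N}(0,\sigma^2I)*\mu$: $\mathrm{d}_\sigma(x)=-\sigma^2\log p_\sigma(x)$, $\pi_\sigma(x)=x+\sigma^2\nabla\log p_\sigma(x)$, $P_\sigma(x)=I+\sigma^2\nabla^2\log p_\sigma(x)$, and $F_\sigma^\eta(x)=f(\pi_\sigma(x))+\eta\,\mathrm{d}_\sigma(x)$. *)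

theory Defs
  imports "HOL-Analysis.Analysis" "HOL-Probability.Probability"
begin

definition C1_on :: "'a::euclidean_space set \<Rightarrow> ('a \<Rightarrow> 'b::real_normed_vector) \<Rightarrow> bool" where
  "C1_on S f \<longleftrightarrow> (\<exists>f'. (\<forall>x\<in>S. (f has_derivative blinfun_apply (f' x)) (at x)) \<and> continuous_on S f')"

definition C2_on :: "'a::euclidean_space set \<Rightarrow> ('a \<Rightarrow> 'b::real_normed_vector) \<Rightarrow> bool" where
  "C2_on S f \<longleftrightarrow> (\<exists>f'. (\<forall>x\<in>S. (f has_derivative blinfun_apply (f' x)) (at x)) \<and> C1_on S f')"

text \<open>M is an embedded C^2 submanifold without boundary: around every point there is a
  C^2 diffeomorphism of an open neighbourhood onto an open set, straightening M onto a fixed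
  linear subspace L (playing the role of R^m x 0).\<close>
definition C2_submanifold :: "'a::euclidean_space set \<Rightarrow> bool" where
  "C2_submanifold M \<longleftrightarrow> (\<exists>L. subspace L \<and> (\<forall>p\<in>M. \<exists>U V (\<phi>::'a \<Rightarrow> 'a) (\<psi>::'a \<Rightarrow> 'a).
      open U \<and> p \<in> U \<and> open V \<and> \<phi> ` U = V \<and> \<psi> ` V = U \<and>
      (\<forall>x\<in>U. \<psi> (\<phi> x) = x) \<and> (\<forall>y\<in>V. \<phi> (\<psi> y) = y) \<and>
      C2_on U \<phi> \<and> C2_on V \<psi> \<and> \<phi> ` (M \<inter> U) = V \<inter> L))"

definition tangent_space :: "'a::euclidean_space set \<Rightarrow> 'a \<Rightarrow> 'a set" where
  "tangent_space M p = {v. \<exists>e>0. \<exists>c::real \<Rightarrow> 'a. (\<forall>t\<in>{-e<..<e}. c t \<in> M) \<and> c 0 = p \<and>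
      (c has_vector_derivative v) (at 0)}"

definition normal_space :: "'a::euclidean_space set \<Rightarrow> 'a \<Rightarrow> 'a set" where
  "normal_space M p = {v. \<forall>w\<in>tangent_space M p. inner v w = 0}"

definition normal_bundle :: "'a::euclidean_space set \<Rightarrow> real \<Rightarrow> ('a \<times> 'a) set" where
  "normal_bundle M t = {(p, v). p \<in> M \<and> v \<in> normal_space M p \<and> norm v < t}"

definition tube :: "'a::euclidean_space set \<Rightarrow> real \<Rightarrow> 'a set" where
  "tube M t = (\<lambda>(p, v). p + v) ` normal_bundle M t"

definition normal_map_diffeo :: "'a::euclidean_space set \<Rightarrow> real \<Rightarrow> bool" where
  "normal_map_diffeo M t \<longleftrightarrow>
     inj_on (\<lambda>(p, v). p + v) (normal_bundle M t) \<and> open (tube M t) \<and>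
     (\<exists>g. C1_on (tube M t) g \<and> (\<forall>(p, v)\<in>normal_bundle M t. g (p + v) = (p, v)))"

definition reach :: "'a::euclidean_space set \<Rightarrow> real" where
  "reach M = Sup {t. t \<ge> 0 \<and> normal_map_diffeo M t}"

definition proj :: "'a::euclidean_space set \<Rightarrow> 'a \<Rightarrow> 'a" where
  "proj M x = (THE p. p \<in> M \<and> (\<forall>q\<in>M. dist x p \<le> dist x q))"

definition P0 :: "'a::euclidean_space set \<Rightarrow> 'a \<Rightarrow> 'a \<Rightarrow> 'a" where
  "P0 M x = frechet_derivative (proj M) (at x)"

definition grad :: "('a::euclidean_space \<Rightarrow> real) \<Rightarrow> 'a \<Rightarrow> 'a" where
  "grad g x = (\<Sum>b\<in>Basis. frechet_derivative g (at x) b *\<^sub>R b)"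

definition hess :: "('a::euclidean_space \<Rightarrow> real) \<Rightarrow> 'a \<Rightarrow> 'a \<Rightarrow> 'a" where
  "hess g x = frechet_derivative (grad g) (at x)"

text \<open>Density of N(0, sigma^2 I) * mu.\<close>
definition p_sigma :: "'a::euclidean_space measure \<Rightarrow> real \<Rightarrow> 'a \<Rightarrow> real" where
  "p_sigma \<mu> \<sigma> x = (LINT y|\<mu>. (2 * pi * \<sigma>\<^sup>2) powr (- real DIM('a) / 2) *
      exp (- (norm (x - y))\<^sup>2 / (2 * \<sigma>\<^sup>2)))"

definition d_sigma :: "'a::euclidean_space measure \<Rightarrow> real \<Rightarrow> 'a \<Rightarrow> real" where
  "d_sigma \<mu> \<sigma> x = - \<sigma>\<^sup>2 * ln (p_sigma \<mu> \<sigma> x)"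

definition pi_sigma :: "'a::euclidean_space measure \<Rightarrow> real \<Rightarrow> 'a \<Rightarrow> 'a" where
  "pi_sigma \<mu> \<sigma> x = x + \<sigma>\<^sup>2 *\<^sub>R grad (\<lambda>z. ln (p_sigma \<mu> \<sigma> z)) x"

definition P_sigma :: "'a::euclidean_space measure \<Rightarrow> real \<Rightarrow> 'a \<Rightarrow> 'a \<Rightarrow> 'a" where
  "P_sigma \<mu> \<sigma> x = (\<lambda>h. h + \<sigma>\<^sup>2 *\<^sub>R hess (\<lambda>z. ln (p_sigma \<mu> \<sigma> z)) x h)"

definition F_sigma :: "'a::euclidean_space measure \<Rightarrow> ('a \<Rightarrow> real) \<Rightarrow> real \<Rightarrow> real \<Rightarrow> 'a \<Rightarrow> real" where
  "F_sigma \<mu> f \<sigma> \<eta> x = f (pi_sigma \<mu> \<sigma> x) + \<eta> * d_sigma \<mu> \<sigma> x"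

definition gamma_tubular :: "real \<Rightarrow> real \<Rightarrow> real \<Rightarrow> real \<Rightarrow> real" where
  "gamma_tubular C \<epsilon> \<tau> \<eta> = \<tau> * min (1 / (2 * (C * (\<epsilon> + 2) + 2 * \<eta> * \<tau>)))
      ((1/4 * \<eta> * \<tau> - 1/2 * (C + \<eta>) * \<epsilon>) / (4 * (C * (\<epsilon> + 4) + 3 * \<eta> * \<tau>)\<^sup>2))"

end

theory Submission
  imports Defs
begin

text \<open>For compact \<open>M\<close> a nearest point is always reached along a normal vector, so the tube is just
  the open \<open>\<tau>\<close>-neighbourhood of \<open>M\<close>, and injectivity of the normal map makes the nearest point
  unique. Below half the reach the projection is 2-Lipschitz, whence \<open>\<parallel>P0\<parallel> \<le> 2\<close>, and \<open>P0\<close>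
  annihilates the normal vector \<open>v = x - proj M x\<close>. As the gradient of \<open>F_sigma\<close> pairs with \<open>h\<close>
  to \<open>grad f (pi_sigma x) \<bullet> P_sigma x h + \<eta> (x - pi_sigma x) \<bullet> h\<close>, it is bounded by
  \<open>C (\<epsilon> + 2) + 2 \<eta> \<tau>\<close>, and its inner product with \<open>v\<close> is at least
  \<open>\<parallel>v\<parallel> (\<eta> \<parallel>v\<parallel> - (C + \<eta>) \<epsilon>)\<close>.
  If \<open>\<parallel>v\<parallel> < \<tau> / 2\<close>, a step has length at most \<open>\<tau> / 2\<close> and stays in the tube; otherwise it does
  not increase the distance to \<open>proj M x\<close>.\<close>

section \<open>Tubular neighbourhoods and the nearest-point projection\<close>

text \<open>Along a curve in \<open>M\<close> through \<open>p\<close> the squared distance to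
  \<open>x\<close> has a local minimum at parameter 0, and its derivative there is
  \<open>- 2 * ((x - p) \<bullet> w)\<close>.\<close>

lemma nearest_point_imp_normal:
  fixes M :: "'a::euclidean_space set"
  assumes "\<And>q. q \<in> M \<Longrightarrow> dist x p \<le> dist x q"
  shows "x - p \<in> normal_space M p"
  unfolding normal_space_def
proof (intro CollectI ballI)
  fix w assume "w \<in> tangent_space M p"
  then obtain e c where e: "e > 0" and cM: "\<And>t. t \<in> {-e<..<e} \<Longrightarrow> c t \<in> M" and c0: "c 0 = p"
    and c: "(c has_vector_derivative w) (at 0)"
    unfolding tangent_space_def by blast
  have c': "(c has_derivative (\<lambda>t. t *\<^sub>R w)) (at 0)"
    using c by (simp add: has_vector_derivative_def)
  have "((\<lambda>t. (x - c t) \<bullet> (x - c t)) has_derivative (\<lambda>t. - 2 * ((x - p) \<bullet> w) * t)) (at 0)"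
    by (auto intro!: derivative_eq_intros c' simp: c0 inner_commute algebra_simps)
  then have D: "((\<lambda>t. (x - c t) \<bullet> (x - c t)) has_real_derivative (- 2 * ((x - p) \<bullet> w))) (at 0)"
    unfolding has_field_derivative_def .
  have "(x - c 0) \<bullet> (x - c 0) \<le> (x - c t) \<bullet> (x - c t)" if "\<bar>0 - t\<bar> < e" for t
  proof -
    have "c t \<in> M" using that by (intro cM) auto
    then have "norm (x - p) \<le> norm (x - c t)" using assms by (simp add: dist_norm)
    then have "(norm (x - p))\<^sup>2 \<le> (norm (x - c t))\<^sup>2" by (simp add: power_mono)
    then show ?thesis by (simp add: c0 power2_norm_eq_inner)
  qed
  then have "- 2 * ((x - p) \<bullet> w) = 0"
    using DERIV_local_min[OF D e] by blast
  then show "(x - p) \<bullet> w = 0" by simp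
qed

lemma compact_nearest_point:
  fixes M :: "'a::euclidean_space set"
  assumes "compact M" "p \<in> M"
  obtains q where "q \<in> M" "\<And>y. y \<in> M \<Longrightarrow> dist x q \<le> dist x y" "x - q \<in> normal_space M q"
proof -
  obtain q where q: "q \<in> M" "\<And>y. y \<in> M \<Longrightarrow> dist x q \<le> dist x y"
    using distance_attains_inf[of M x] assms compact_imp_closed by blast
  then show thesis using that nearest_point_imp_normal[of M x q] by blast
qed

text \<open>Passing from a close point to a nearest one makes the offset normal without lengthening
  it, whatever the size of \<open>t\<close>. Tube membership thus becomes a metric condition that
  any point of \<open>M\<close> may witness.\<close>

lemma mem_tube_iff:
  fixes M :: "'a::euclidean_space set"
  assumes "compact M"
  shows "x \<in> tube M t \<longleftrightarrow> (\<exists>p\<in>M. dist x p < t)"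
proof
  assume "x \<in> tube M t"
  then show "\<exists>p\<in>M. dist x p < t"
    by (force simp: tube_def normal_bundle_def dist_norm)
next
  assume "\<exists>p\<in>M. dist x p < t"
  then obtain p where p: "p \<in> M" "dist x p < t" by blast
  obtain q where q: "q \<in> M" "\<And>y. y \<in> M \<Longrightarrow> dist x q \<le> dist x y" "x - q \<in> normal_space M q"
    using compact_nearest_point[OF assms p(1)] by blast
  have "norm (x - q) < t" using q(2)[OF p(1)] p(2) by (simp add: dist_norm)
  then have "(q, x - q) \<in> normal_bundle M t" using q by (simp add: normal_bundle_def)
  then show "x \<in> tube M t" unfolding tube_def by (force intro!: image_eqI[of _ _ "(q, x - q)"])
qed

lemma open_tube:
  fixes M :: "'a::euclidean_space set"
  assumes "compact M"
  shows "open (tube M t)"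
proof -
  have "tube M t = (\<Union>p\<in>M. ball p t)"
    using mem_tube_iff[OF assms] by (auto simp: dist_commute)
  then show ?thesis by auto
qed

lemma bounded_tube:
  fixes M :: "'a::euclidean_space set"
  assumes "compact M"
  shows "bounded (tube M t)"
proof -
  obtain B where B: "\<And>p. p \<in> M \<Longrightarrow> norm p \<le> B"
    using compact_imp_bounded[OF assms] by (auto simp: bounded_iff)
  have "norm x \<le> B + t" if x: "x \<in> tube M t" for x
  proof -
    obtain p where p: "p \<in> M" "dist x p < t" using x unfolding mem_tube_iff[OF assms] ..
    show ?thesis using B[OF p(1)] p(2) norm_triangle_sub[of x p] by (simp add: dist_norm)
  qed
  then show ?thesis by (auto simp: bounded_iff)
qed

section \<open>Radii below the reach\<close>

lemma normal_bundle_mono: "s \<le> t \<Longrightarrow> normal_bundle M s \<subseteq> normal_bundle M t"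
  by (auto simp: normal_bundle_def)

lemma normal_map_diffeo_mono:
  fixes M :: "'a::euclidean_space set"
  assumes "compact M" "normal_map_diffeo M t" "s \<le> t"
  shows "normal_map_diffeo M s"
proof -
  have sub: "normal_bundle M s \<subseteq> normal_bundle M t" and sub': "tube M s \<subseteq> tube M t"
    using normal_bundle_mono[OF assms(3), of M] by (auto simp: tube_def)
  obtain g where g: "C1_on (tube M t) g" "\<forall>(p, v)\<in>normal_bundle M t. g (p + v) = (p, v)"
    and inj: "inj_on (\<lambda>(p, v). p + v) (normal_bundle M t)"
    using assms(2) unfolding normal_map_diffeo_def by blast
  have "C1_on (tube M s) g"
    using g(1) sub' unfolding C1_on_def by (meson continuous_on_subset subsetD)
  then show ?thesis
    unfolding normal_map_diffeo_def
    using inj_on_subset[OF inj sub] open_tube[OF assms(1)] g(2) sub by blast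
qed

text \<open>The admissible radii form an initial segment containing 0, so one radius above
  \<open>s\<close> suffices. If they are unbounded, as for a single point, \<open>Sup\<close>
  carries no information, but a radius above \<open>s\<close> then exists directly.\<close>

lemma normal_map_diffeo_below_reach:
  fixes M :: "'a::euclidean_space set"
  assumes "compact M" "s < reach M"
  shows "normal_map_diffeo M s"
proof -
  let ?X = "{t. t \<ge> 0 \<and> normal_map_diffeo M t}"
  have "normal_bundle M 0 = {}" by (auto simp: normal_bundle_def)
  then have "0 \<in> ?X" by (simp add: normal_map_diffeo_def tube_def C1_on_def)
  have "\<exists>t\<in>?X. s < t"
  proof (cases "bdd_above ?X")
    case True
    then show ?thesis
      using less_cSup_iff[of ?X s] \<open>0 \<in> ?X\<close> assms(2) unfolding reach_def by blast
  next
    case False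
    then show ?thesis unfolding bdd_above_def by (meson not_le)
  qed
  then show ?thesis using normal_map_diffeo_mono[OF assms(1)] by fastforce
qed

section \<open>Uniqueness of the nearest point\<close>

text \<open>A nearest point \<open>q\<close> gives a second pair \<open>(q, p + v - q)\<close> of
  the bundle with the same sum: its offset is normal by minimality and no longer than
  \<open>v\<close>. Injectivity identifies the two pairs.\<close>

lemma normal_bundle_nearest:
  fixes M :: "'a::euclidean_space set"
  assumes "compact M" "normal_map_diffeo M t" "(p, v) \<in> normal_bundle M t" "q \<in> M"
    "\<And>y. y \<in> M \<Longrightarrow> dist (p + v) q \<le> dist (p + v) y"
  shows "q = p"
proof -
  have inj: "inj_on (\<lambda>(p, v). p + v) (normal_bundle M t)"
    using assms(2) unfolding normal_map_diffeo_def by blast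
  have p: "p \<in> M" "norm v < t" using assms(3) by (auto simp: normal_bundle_def)
  have "norm (p + v - q) < t" using assms(5)[OF p(1)] p(2) by (simp add: dist_norm)
  moreover have "p + v - q \<in> normal_space M q"
    by (rule nearest_point_imp_normal) (rule assms(5))
  ultimately have "(q, p + v - q) \<in> normal_bundle M t"
    using assms(4) by (simp add: normal_bundle_def)
  then have "(q, p + v - q) = (p, v)"
    using assms(3) by (intro inj_onD[OF inj, of "(q, p + v - q)"]) simp_all
  then show ?thesis by (elim Pair_inject)
qed

lemma normal_bundle_dist_le:
  fixes M :: "'a::euclidean_space set"
  assumes "compact M" "normal_map_diffeo M t" "(p, v) \<in> normal_bundle M t" "y \<in> M"
  shows "dist (p + v) p \<le> dist (p + v) y"
proof -
  obtain q where q: "q \<in> M" "\<And>y. y \<in> M \<Longrightarrow> dist (p + v) q \<le> dist (p + v) y"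
    using compact_nearest_point[OF assms(1,4), of "p + v"] by metis
  then show ?thesis using normal_bundle_nearest[OF assms(1-3), of q] assms(4) by simp
qed

lemma proj_normal_bundle:
  fixes M :: "'a::euclidean_space set"
  assumes "compact M" "normal_map_diffeo M t" "(p, v) \<in> normal_bundle M t"
  shows "proj M (p + v) = p"
  unfolding proj_def
proof (rule the_equality)
  show "p \<in> M \<and> (\<forall>q\<in>M. dist (p + v) p \<le> dist (p + v) q)"
    using assms normal_bundle_dist_le[OF assms] by (auto simp: normal_bundle_def)
qed (use normal_bundle_nearest[OF assms] in blast)

lemma tube_proj:
  fixes M :: "'a::euclidean_space set"
  assumes "compact M" "normal_map_diffeo M t" "x \<in> tube M t"
  shows "(proj M x, x - proj M x) \<in> normal_bundle M t"
proof -
  obtain p v where "(p, v) \<in> normal_bundle M t" "x = p + v"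
    using assms(3) unfolding tube_def by auto
  then show ?thesis using proj_normal_bundle[OF assms(1,2)] by simp
qed

text \<open>On the open tube \<open>proj M\<close> is the first component of the C1 inverse of the
  normal map, so the \<open>frechet_derivative\<close> inside \<open>P0\<close> is a genuine
  derivative.\<close>

lemma proj_has_derivative_P0:
  fixes M :: "'a::euclidean_space set"
  assumes "compact M" "normal_map_diffeo M t" "x \<in> tube M t"
  shows "(proj M has_derivative P0 M x) (at x)"
proof -
  obtain g where g: "C1_on (tube M t) g" "\<forall>(p, v)\<in>normal_bundle M t. g (p + v) = (p, v)"
    using assms(2) unfolding normal_map_diffeo_def by blast
  obtain D where D: "(g has_derivative D) (at x)"
    using g(1) assms(3) unfolding C1_on_def by blast
  have "((\<lambda>z. fst (g z)) has_derivative (\<lambda>h. fst (D h))) (at x)"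
    by (rule has_derivative_fst[OF D])
  moreover have "fst (g z) = proj M z" if "z \<in> tube M t" for z
    using g(2) tube_proj[OF assms(1,2) that] by fastforce
  ultimately have "(proj M has_derivative (\<lambda>h. fst (D h))) (at x)"
    using has_derivative_transform_within_open[OF _ open_tube[OF assms(1)] assms(3)] by blast
  then show ?thesis
    using frechet_derivative_at[of "proj M" _ x] unfolding P0_def by metis
qed

text \<open>The point \<open>p\<close> stays nearest to \<open>p + s u\<close> for every unit normal \<open>u\<close>, so the ball of
  radius \<open>s\<close> touching \<open>M\<close> at \<open>p\<close> contains no point of \<open>M\<close> in its interior.\<close>
lemma normal_inner_le:
  fixes M :: "'a::euclidean_space set"
  assumes "compact M" "normal_map_diffeo M t" "p \<in> M" "a \<in> normal_space M p"
    "0 \<le> s" "s < t" "q \<in> M"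
  shows "2 * s * ((q - p) \<bullet> a) \<le> norm a * (norm (q - p))\<^sup>2"
proof (cases "a = 0")
  case False
  \<comment> \<open>The bundle reaches up to \<open>t\<close>, so \<open>a\<close> may be rescaled
    to length exactly \<open>s\<close>; this produces the factor \<open>norm a / s\<close>, which is
    small for short \<open>a\<close>.\<close>
  define u where "u = (s / norm a) *\<^sub>R a"
  have "(p, u) \<in> normal_bundle M t"
    using assms(3-6) False by (auto simp: u_def normal_bundle_def normal_space_def)
  then have "norm u \<le> norm (p + u - q)"
    using normal_bundle_dist_le[OF assms(1,2) _ assms(7)] by (fastforce simp: dist_norm)
  then have "(norm u)\<^sup>2 \<le> (norm (u - (q - p)))\<^sup>2" by (simp add: power_mono algebra_simps)
  then have "2 * (u \<bullet> (q - p)) \<le> (norm (q - p))\<^sup>2"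
    by (simp add: power2_norm_eq_inner inner_diff inner_commute)
  then have "norm a * (2 * (u \<bullet> (q - p))) \<le> norm a * (norm (q - p))\<^sup>2"
    by (simp add: mult_left_mono)
  then show ?thesis using False by (simp add: u_def inner_commute)
qed simp

text \<open>This is Federer's estimate. Pair \<open>x - y = (p - q) + a - b\<close> with
  \<open>p - q\<close>: by the touching-ball inequality each normal offset consumes at most the
  fraction \<open>r / (2 * s)\<close> of the squared norm of \<open>p - q\<close>. Cauchy-Schwarz
  and cancelling one factor \<open>norm (p - q)\<close> finish.\<close>

lemma proj_Lipschitz:
  fixes M :: "'a::euclidean_space set"
  assumes "compact M" "normal_map_diffeo M t" "r \<le> s" "s < t" "x \<in> tube M r" "y \<in> tube M r"
  shows "(s - r) * norm (proj M x - proj M y) \<le> s * norm (x - y)"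
proof -
  define p q a b where defs: "p = proj M x" "q = proj M y" "a = x - p" "b = y - q"
  have "normal_map_diffeo M r"
    using assms normal_map_diffeo_mono[of M t r] by simp
  from tube_proj[OF assms(1) this assms(5)] tube_proj[OF assms(1) this assms(6)]
  have pa: "p \<in> M" "a \<in> normal_space M p" "norm a < r"
    and qb: "q \<in> M" "b \<in> normal_space M q" "norm b < r"
    by (auto simp: defs normal_bundle_def)
  have s0: "0 \<le> s" using pa(3) assms(3) norm_ge_zero[of a] by linarith
  let ?D = "norm (p - q)"
  have 1: "2 * s * ((q - p) \<bullet> a) \<le> r * ?D\<^sup>2"
  proof -
    have "2 * s * ((q - p) \<bullet> a) \<le> norm a * ?D\<^sup>2"
      using normal_inner_le[OF assms(1,2) pa(1,2) s0 assms(4) qb(1)] by (simp add: norm_minus_commute)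
    also have "\<dots> \<le> r * ?D\<^sup>2" using pa(3) by (simp add: mult_right_mono)
    finally show ?thesis .
  qed
  have 2: "2 * s * ((p - q) \<bullet> b) \<le> r * ?D\<^sup>2"
  proof -
    have "2 * s * ((p - q) \<bullet> b) \<le> norm b * ?D\<^sup>2"
      using normal_inner_le[OF assms(1,2) qb(1,2) s0 assms(4) pa(1)] by simp
    also have "\<dots> \<le> r * ?D\<^sup>2" using qb(3) by (simp add: mult_right_mono)
    finally show ?thesis .
  qed
  have "(x - y) \<bullet> (p - q) = ?D\<^sup>2 - (q - p) \<bullet> a - (p - q) \<bullet> b"
    by (simp add: defs power2_norm_eq_inner inner_diff inner_commute)
  then have "s * ((x - y) \<bullet> (p - q)) = s * ?D\<^sup>2 - s * ((q - p) \<bullet> a) - s * ((p - q) \<bullet> b)"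
    by (simp add: right_diff_distrib)
  with 1 2 have "(s - r) * ?D\<^sup>2 \<le> s * ((x - y) \<bullet> (p - q))"
    by (simp add: left_diff_distrib)
  also have "\<dots> \<le> s * (norm (x - y) * ?D)"
    using s0 norm_cauchy_schwarz by (intro mult_left_mono)
  finally have *: "((s - r) * ?D) * ?D \<le> (s * norm (x - y)) * ?D"
    by (simp add: power2_eq_square mult.assoc)
  show ?thesis
  proof (cases "?D = 0")
    case True
    then show ?thesis using s0 by (simp add: defs)
  next
    case False
    then show ?thesis using * by (simp add: defs)
  qed
qed

section \<open>Norm and kernel of the derivative of the projection\<close>

lemma has_derivative_along_line:
  assumes "(f has_derivative D) (at x)"
  shows "((\<lambda>t::real. f (x + t *\<^sub>R h)) has_vector_derivative D h) (at 0)"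
proof -
  interpret D: bounded_linear D using assms by (rule has_derivative_bounded_linear)
  have "((\<lambda>t::real. x + t *\<^sub>R h) has_derivative (\<lambda>t. t *\<^sub>R h)) (at 0)"
    by (auto intro!: derivative_eq_intros)
  then have "((\<lambda>t::real. f (x + t *\<^sub>R h)) has_derivative (\<lambda>t. D (t *\<^sub>R h))) (at 0)"
    by (rule has_derivative_compose) (simp add: assms)
  then show ?thesis by (simp add: has_vector_derivative_def D.scaleR)
qed

lemma has_derivative_norm_le_of_Lipschitz:
  assumes D: "(f has_derivative D) (at x)" and S: "open S" "x \<in> S"
    and L: "\<And>y. y \<in> S \<Longrightarrow> norm (f y - f x) \<le> L * norm (y - x)"
  shows "norm (D h) \<le> L * norm h"
proof -
  \<comment> \<open>\<open>r t\<close> is the remainder quotient of \<open>f\<close> along the line;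
    once \<open>norm (D h) \<le> L * norm h + r t\<close> holds for small nonzero \<open>t\<close>,
    the limit gives the claim.\<close>
  define r where "r t = norm (f (x + t *\<^sub>R h) - f x - t *\<^sub>R D h) / norm t" for t :: real
  have "(r \<longlongrightarrow> 0) (at 0)"
    using has_derivative_along_line[OF D, of h]
    by (simp add: has_vector_derivative_def has_derivative_iff_norm r_def [abs_def])
  then have lim: "((\<lambda>t. L * norm h + r t) \<longlongrightarrow> L * norm h + 0) (at 0)"
    by (intro tendsto_intros)
  have "((\<lambda>t::real. x + t *\<^sub>R h) \<longlongrightarrow> x + 0 *\<^sub>R h) (at 0)"
    by (intro tendsto_intros)
  then have "eventually (\<lambda>t::real. x + t *\<^sub>R h \<in> S) (at 0)"
    using S by (auto dest!: topological_tendstoD)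
  moreover have "eventually (\<lambda>t::real. t \<noteq> 0) (at 0)" by (simp add: eventually_at_filter)
  ultimately have "eventually (\<lambda>t. norm (D h) \<le> L * norm h + r t) (at 0)"
  proof eventually_elim
    case (elim t)
    have "\<bar>t\<bar> * norm (D h) \<le> norm (f (x + t *\<^sub>R h) - f x) + \<bar>t\<bar> * r t"
      using norm_triangle_ineq4[of "f (x + t *\<^sub>R h) - f x" "f (x + t *\<^sub>R h) - f x - t *\<^sub>R D h"] elim(2)
      by (simp add: r_def)
    also have "\<dots> \<le> \<bar>t\<bar> * (L * norm h + r t)"
      using L[OF elim(1)] by (simp add: algebra_simps)
    finally show ?case using elim(2) by simp
  qed
  then show ?thesis using tendsto_lowerbound[OF lim] by simp
qed

text \<open>With \<open>v = x - p\<close>, the points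
  \<open>x + s *\<^sub>R v = p + (1 + s) *\<^sub>R v\<close> lie on a normal at \<open>p\<close>
  and, for small \<open>s\<close>, within length \<open>t\<close>; so the projection is constant
  along this line.\<close>

lemma P0_normal_eq_0:
  fixes M :: "'a::euclidean_space set"
  assumes "compact M" "normal_map_diffeo M t" "x \<in> tube M t"
  shows "P0 M x (x - proj M x) = 0"
proof -
  define p v where pv: "p = proj M x" "v = x - p"
  have b: "(p, v) \<in> normal_bundle M t"
    using tube_proj[OF assms] by (simp add: pv)
  have "((\<lambda>s::real. norm ((1 + s) *\<^sub>R v)) \<longlongrightarrow> norm ((1 + 0) *\<^sub>R v)) (at 0)"
    by (intro tendsto_intros)
  then have "eventually (\<lambda>s::real. norm ((1 + s) *\<^sub>R v) < t) (at 0)"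
    using b order_tendstoD(2)[of _ "norm v" _ t] by (fastforce simp: normal_bundle_def)
  then have "eventually (\<lambda>s::real. proj M (x + s *\<^sub>R v) = p) (at 0)"
  proof eventually_elim
    case (elim s)
    then have "(p, (1 + s) *\<^sub>R v) \<in> normal_bundle M t"
      using b by (simp add: normal_bundle_def normal_space_def)
    from proj_normal_bundle[OF assms(1,2) this] show ?case
      by (simp add: pv algebra_simps)
  qed
  moreover have "((\<lambda>s::real. proj M (x + s *\<^sub>R v)) has_derivative (\<lambda>s. s *\<^sub>R P0 M x v)) (at 0)"
    using has_derivative_along_line[OF proj_has_derivative_P0[OF assms]]
    by (simp add: has_vector_derivative_def)
  ultimately have "((\<lambda>s::real. p) has_derivative (\<lambda>s. s *\<^sub>R P0 M x v)) (at 0)"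
    using has_derivative_transform_eventually[of "\<lambda>s. proj M (x + s *\<^sub>R v)" _ 0 UNIV "\<lambda>s. p"]
    by (simp add: pv)
  then have "(\<lambda>s::real. s *\<^sub>R P0 M x v) = (\<lambda>s. 0)"
    using has_derivative_unique has_derivative_const by blast
  then have "1 *\<^sub>R P0 M x v = 0" by metis
  then show ?thesis by (simp add: pv)
qed

section \<open>Differentiating the smoothed density\<close>

lemma grad_eqI:
  assumes "(g has_derivative (\<lambda>h. v \<bullet> h)) (at x)"
  shows "grad g x = v"
  unfolding grad_def frechet_derivative_at[OF assms, symmetric]
  by (rule euclidean_representation)

text \<open>Expanding \<open>h\<close> in the basis shows that the coordinate sum defining
  \<open>grad\<close> is the Riesz representative of the derivative.\<close>

lemma inner_grad:
  assumes "(g has_derivative D) (at x)"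
  shows "grad g x \<bullet> h = D h"
proof -
  interpret D: bounded_linear D using assms by (rule has_derivative_bounded_linear)
  have "grad g x \<bullet> h = (\<Sum>b\<in>Basis. D b * (b \<bullet> h))"
    unfolding grad_def frechet_derivative_at[OF assms, symmetric] by (simp add: inner_sum_left)
  also have "\<dots> = D (\<Sum>b\<in>Basis. (h \<bullet> b) *\<^sub>R b)"
    unfolding D.sum D.scaleR by (simp add: inner_commute mult.commute)
  finally show ?thesis by (simp add: euclidean_representation)
qed

lemma C1_on_UNIV_grad:
  assumes "C1_on UNIV f"
  shows "(f has_derivative (\<lambda>h. grad f x \<bullet> h)) (at x)" and "continuous_on UNIV (grad f)"
proof -
  obtain f' where f': "\<And>x. (f has_derivative blinfun_apply (f' x)) (at x)" "continuous_on UNIV f'"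
    using assms unfolding C1_on_def by auto
  show "(f has_derivative (\<lambda>h. grad f x \<bullet> h)) (at x)"
    using f'(1)[of x] inner_grad[OF f'(1)] by presburger
  have "grad f = (\<lambda>x. \<Sum>b\<in>Basis. f' x b *\<^sub>R b)"
    using frechet_derivative_at[OF f'(1)] by (auto simp: grad_def fun_eq_iff)
  moreover have "continuous_on UNIV (\<lambda>x. \<Sum>b\<in>Basis. f' x b *\<^sub>R b)"
    by (intro continuous_intros f'(2))
  ultimately show "continuous_on UNIV (grad f)" by simp
qed

text \<open>Derivatives enter as plain functions, the form that derivative rules produce; in finite
  dimension, continuity on basis vectors gives continuity in operator norm.\<close>

lemma C1_onI:
  fixes f :: "'a::euclidean_space \<Rightarrow> 'b::real_normed_vector"
  assumes D: "\<And>x. x \<in> S \<Longrightarrow> (f has_derivative D x) (at x)"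
    and cont: "\<And>b. b \<in> Basis \<Longrightarrow> continuous_on S (\<lambda>x. D x b)"
  shows "C1_on S f"
proof -
  have B: "blinfun_apply (Blinfun (D x)) = D x" if "x \<in> S" for x
    using D[OF that] by (simp add: bounded_linear_Blinfun_apply has_derivative_bounded_linear)
  have "continuous_on S (\<lambda>x. Blinfun (D x))"
  proof (rule continuous_on_blinfun_componentwise)
    fix i :: 'a assume "i \<in> Basis"
    then show "continuous_on S (\<lambda>x. blinfun_apply (Blinfun (D x)) i)"
      using cont[of i] B by (simp cong: continuous_on_cong)
  qed
  then show ?thesis unfolding C1_on_def using D B by (intro exI[of _ "\<lambda>x. Blinfun (D x)"]) auto
qed

section \<open>The Gaussian kernel\<close>

definition gauss :: "real \<Rightarrow> 'a::euclidean_space \<Rightarrow> real" where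
  "gauss \<sigma> z = (2 * pi * \<sigma>\<^sup>2) powr (- real DIM('a) / 2) * exp (- (norm z)\<^sup>2 / (2 * \<sigma>\<^sup>2))"

lemma gauss_has_derivative:
  assumes "\<sigma> > 0"
  shows "(gauss \<sigma> has_derivative (\<lambda>h. (- (gauss \<sigma> z / \<sigma>\<^sup>2) *\<^sub>R z) \<bullet> h)) (at z)"
  unfolding gauss_def [abs_def] power2_norm_eq_inner
  using assms
  by (auto intro!: derivative_eq_intros simp: inner_commute fun_eq_iff field_simps)

lemma continuous_on_gauss [continuous_intros]:
  "continuous_on S g \<Longrightarrow> continuous_on S (\<lambda>x. gauss \<sigma> (g x))"
  \<comment> \<open>Division by zero is zero, so for \<open>\<sigma> = 0\<close> the function is
    constant.\<close>
  unfolding gauss_def by (cases "\<sigma> = 0") (auto intro!: continuous_intros)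

section \<open>Integrals against a probability measure carried by a compact set\<close>

context
  fixes M :: "'a::euclidean_space set" and \<mu> :: "'a measure"
  assumes compact: "compact M" and prob: "prob_space \<mu>"
    and sets_\<mu>: "sets \<mu> = sets borel" and supp: "AE y in \<mu>. y \<in> M"
begin

lemma integrable_continuous_compact_support:
  fixes w :: "'a \<Rightarrow> 'b::euclidean_space"
  assumes "continuous_on UNIV w"
  shows "integrable \<mu> w"
proof -
  interpret prob_space \<mu> by (rule prob)
  have "compact (w ` M)"
    using compact assms by (meson compact_continuous_image continuous_on_subset top_greatest)
  then obtain B where B: "\<And>y. y \<in> M \<Longrightarrow> norm (w y) \<le> B"
    using compact_imp_bounded[of "w ` M"] unfolding bounded_iff by auto
  have "w \<in> borel_measurable \<mu>"
    using borel_measurable_continuous_onI[OF assms] measurable_cong_sets[OF sets_\<mu> refl] by blast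
  then show ?thesis
    using supp B by (intro integrable_const_bound[of _ B]) (auto elim: eventually_mono)
qed

lemma integrable_translate:
  fixes w :: "'a \<Rightarrow> 'b::euclidean_space"
  assumes "continuous_on UNIV w"
  shows "integrable \<mu> (\<lambda>y. w (x - y))"
  by (intro integrable_continuous_compact_support continuous_on_compose2[OF assms] continuous_intros) auto

text \<open>For \<open>y \<in> M\<close> and \<open>x'\<close> near \<open>x\<close>, all points
  \<open>x' - y\<close> stay in one compact ball, where the derivative is uniformly continuous. The
  linearisation error is therefore at most \<open>e * norm (x' - x)\<close> with the same
  \<open>e\<close> for all \<open>y\<close>, and integration against a probability measure preserves
  this bound.\<close>

lemma has_derivative_integral_translate:
  fixes w :: "'a \<Rightarrow> 'b::euclidean_space"
  assumes C1: "C1_on UNIV w" and D: "\<And>z. (w has_derivative D z) (at z)"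
  shows "((\<lambda>x. LINT y|\<mu>. w (x - y)) has_derivative (\<lambda>h. LINT y|\<mu>. D (x - y) h)) (at x)"
proof -
  interpret prob_space \<mu> by (rule prob)
  obtain w' where w': "\<And>z. (w has_derivative blinfun_apply (w' z)) (at z)"
    and w'_cont: "continuous_on UNIV w'"
    using C1 unfolding C1_on_def by auto
  have D_eq: "D z = blinfun_apply (w' z)" for z
    using has_derivative_unique[OF D w'] .
  have "continuous_on UNIV w"
    using D by (meson continuous_at_imp_continuous_on has_derivative_continuous)
  note int_w = integrable_translate[OF this]
  have int_D: "integrable \<mu> (\<lambda>y. D (x - y) h)" for h
    unfolding D_eq by (rule integrable_translate) (intro continuous_intros w'_cont)
  have lin: "linear (\<lambda>h. LINT y|\<mu>. D (x - y) h)"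
    using int_D unfolding D_eq
    by (intro linearI) (simp_all add: blinfun.add_right blinfun.scaleR_right)
  obtain B where B: "\<And>y. y \<in> M \<Longrightarrow> norm y \<le> B"
    using compact_imp_bounded[OF compact] unfolding bounded_iff by blast
  \<comment> \<open>The radius covers \<open>norm (x - y) \<le> norm x + B\<close> plus a
    displacement below 1; hence the restriction to \<open>min d 1\<close> below.\<close>
  define K where "K = cball (0::'a) (norm x + B + 1)"
  have uc: "uniformly_continuous_on K w'"
    using w'_cont unfolding K_def
    by (intro compact_uniformly_continuous) (auto intro: continuous_on_subset)
  show ?thesis
    unfolding has_derivative_at_alt
  proof (intro conjI allI impI)
    show "bounded_linear (\<lambda>h. LINT y|\<mu>. D (x - y) h)"
      using lin by (simp add: linear_conv_bounded_linear)
  next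
    fix e :: real assume "0 < e"
    then obtain d where d: "d > 0" "\<And>z z'. z \<in> K \<Longrightarrow> z' \<in> K \<Longrightarrow> dist z' z < d \<Longrightarrow> dist (w' z') (w' z) < e"
      using uc unfolding uniformly_continuous_on_def by metis
    have key: "norm (w (x' - y) - w (x - y) - D (x - y) (x' - x)) \<le> e * norm (x' - x)"
      if x': "norm (x' - x) < min d 1" and y: "y \<in> M" for x' y
    proof -
      define S where "S = ball (x - y) (min d 1)"
      have SK: "S \<subseteq> K"
      proof
        fix z assume "z \<in> S"
        then have "norm (z - (x - y)) < 1" by (simp add: S_def dist_norm norm_minus_commute)
        then show "z \<in> K"
          using B[OF y] norm_triangle_ineq[of "z - (x - y)" "x - y"] norm_triangle_ineq4[of x y]
          by (simp add: K_def)
      qed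
      have mem: "x - y \<in> S" using d(1) by (simp add: S_def)
      \<comment> \<open>Mean value inequality on the segment from \<open>x - y\<close> to
        \<open>x' - y\<close>, inside a ball where the derivative deviates from its value at the
        centre by at most \<open>e\<close>.\<close>
      have "norm (w (x' - y) - w (x - y) - blinfun_apply (w' (x - y)) ((x' - y) - (x - y)))
          \<le> norm ((x' - y) - (x - y)) * e"
      proof (rule differentiable_bound_linearization[where S = S])
        fix t :: real assume t: "t \<in> {0..1}"
        then have "norm (t *\<^sub>R (x' - x)) \<le> norm (x' - x)"
          using mult_right_mono[of t 1 "norm (x' - x)"] by simp
        then have "norm (t *\<^sub>R (x' - x)) < min d 1" using x' by linarith
        then show "x - y + t *\<^sub>R (x' - y - (x - y)) \<in> S" by (simp add: S_def dist_norm)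
      next
        fix z assume z: "z \<in> S"
        have "dist (w' z) (w' (x - y)) < e"
          using z mem SK by (intro d(2)) (auto simp: S_def dist_commute)
        then have "norm (w' z - w' (x - y)) \<le> e" by (simp add: dist_norm)
        then show "onorm (blinfun_apply (w' z) - blinfun_apply (w' (x - y))) \<le> e"
          by (simp add: norm_blinfun.rep_eq minus_blinfun.rep_eq fun_diff_def)
      qed (use w' mem has_derivative_at_withinI in blast)+
      then show ?thesis by (simp add: D_eq mult.commute)
    qed
    have "norm ((LINT y|\<mu>. w (x' - y)) - (LINT y|\<mu>. w (x - y)) - (LINT y|\<mu>. D (x - y) (x' - x)))
        \<le> e * norm (x' - x)" if x': "norm (x' - x) < min d 1" for x'
    proof -
      let ?r = "\<lambda>y. w (x' - y) - w (x - y) - D (x - y) (x' - x)"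
      have int: "integrable \<mu> ?r" using int_w int_D by simp
      have "norm (LINT y|\<mu>. ?r y) \<le> (LINT y|\<mu>. norm (?r y))" by simp
      also have "\<dots> \<le> e * norm (x' - x)"
        using supp key[OF x'] int by (intro integral_le_const) (auto elim: eventually_mono)
      finally show ?thesis using int_w int_D by simp
    qed
    then show "\<exists>d>0. \<forall>x'. norm (x' - x) < d \<longrightarrow>
        norm ((LINT y|\<mu>. w (x' - y)) - (LINT y|\<mu>. w (x - y)) - (LINT y|\<mu>. D (x - y) (x' - x)))
        \<le> e * norm (x' - x)"
      using d(1) by (intro exI[of _ "min d 1"]) auto
  qed
qed

text \<open>\<open>w\<close> is the gradient of the kernel and its integral \<open>G\<close> the
  gradient of \<open>p_sigma\<close>; as \<open>w\<close> is again C1, \<open>G\<close> is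
  differentiable. Since \<open>p_sigma\<close> is positive, \<open>grad l\<close> is the quotient of
  \<open>G\<close> by \<open>p_sigma\<close> and inherits differentiability.\<close>

lemma ln_p_sigma_derivatives:
  assumes \<sigma>: "\<sigma> > 0"
  defines "l \<equiv> \<lambda>z. ln (p_sigma \<mu> \<sigma> z)"
  shows "(l has_derivative (\<lambda>h. grad l x \<bullet> h)) (at x)"
    and "(grad l has_derivative hess l x) (at x)"
proof -
  interpret prob_space \<mu> by (rule prob)
  define w where "w z = - (gauss \<sigma> z / \<sigma>\<^sup>2) *\<^sub>R z" for z :: 'a
  define G where "G x = (LINT y|\<mu>. w (x - y))" for x
  have p_eq: "p_sigma \<mu> \<sigma> = (\<lambda>x. LINT y|\<mu>. gauss \<sigma> (x - y))"
    by (simp add: p_sigma_def gauss_def fun_eq_iff)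
  have dg: "(gauss \<sigma> has_derivative (\<lambda>h. w z \<bullet> h)) (at z)" for z
    using gauss_has_derivative[OF \<sigma>] by (simp add: w_def)
  have w_cont: "continuous_on UNIV w"
    unfolding w_def [abs_def] using \<sigma> by (auto intro!: continuous_intros)
  have C1g: "C1_on UNIV (gauss \<sigma> :: 'a \<Rightarrow> real)"
    by (rule C1_onI[OF dg]) (intro continuous_intros w_cont)
  have dw: "(w has_derivative (\<lambda>h. - (gauss \<sigma> z / \<sigma>\<^sup>2) *\<^sub>R h - ((w z \<bullet> h) / \<sigma>\<^sup>2) *\<^sub>R z)) (at z)" for z
  proof -
    have "((\<lambda>z. - (gauss \<sigma> z / \<sigma>\<^sup>2) *\<^sub>R z) has_derivative
        (\<lambda>h. - (gauss \<sigma> z / \<sigma>\<^sup>2) *\<^sub>R h - ((w z \<bullet> h) / \<sigma>\<^sup>2) *\<^sub>R z)) (at z)"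
      using \<sigma> by (auto intro!: derivative_eq_intros dg simp: fun_eq_iff power2_eq_square power4_eq_xxxx)
    then show ?thesis unfolding w_def [abs_def] .
  qed
  have C1w: "C1_on UNIV w"
    using \<sigma> by (intro C1_onI[OF dw]) (auto intro!: continuous_intros w_cont)
  have dp: "(p_sigma \<mu> \<sigma> has_derivative (\<lambda>h. G x \<bullet> h)) (at x)" for x
  proof -
    have "(LINT y|\<mu>. w (x - y) \<bullet> h) = G x \<bullet> h" for h
      unfolding G_def using integrable_translate[OF w_cont] by (intro integral_inner_left) simp
    then show ?thesis
      using has_derivative_integral_translate[OF C1g dg, of x] by (simp add: p_eq)
  qed
  have "G differentiable (at x)" for x
    using has_derivative_integral_translate[OF C1w dw, of x] unfolding G_def [abs_def] differentiable_def
    by blast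
  have p_pos: "p_sigma \<mu> \<sigma> x > 0" for x
  proof -
    have "(LINT y|\<mu>. 0) < (LINT y|\<mu>. gauss \<sigma> (x - y))"
      using \<sigma> by (intro integral_less_AE_space integrable_translate continuous_intros)
        (auto simp: gauss_def emeasure_space_1)
    then show ?thesis by (simp add: p_eq)
  qed
  have dl: "(l has_derivative (\<lambda>h. ((1 / p_sigma \<mu> \<sigma> x) *\<^sub>R G x) \<bullet> h)) (at x)" for x
    unfolding l_def using p_pos[of x]
    by (auto intro!: derivative_eq_intros dp simp: fun_eq_iff divide_inverse)
  have gl: "grad l = (\<lambda>x. (1 / p_sigma \<mu> \<sigma> x) *\<^sub>R G x)"
    using grad_eqI[OF dl] by auto
  show "(l has_derivative (\<lambda>h. grad l x \<bullet> h)) (at x)"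
    using dl by (simp add: gl)
  have "(\<lambda>x. 1 / p_sigma \<mu> \<sigma> x) differentiable (at x)"
    using p_pos[of x] dp[of x] by (intro differentiable_divide) (auto simp: differentiable_def)
  then have "grad l differentiable (at x)"
    unfolding gl using \<open>G differentiable (at x)\<close> by (rule differentiable_scaleR)
  then show "(grad l has_derivative hess l x) (at x)"
    unfolding hess_def by (simp add: frechet_derivative_works)
qed

lemma pi_sigma_has_derivative:
  assumes "\<sigma> > 0"
  shows "(pi_sigma \<mu> \<sigma> has_derivative P_sigma \<mu> \<sigma> x) (at x)"
  unfolding pi_sigma_def [abs_def] P_sigma_def
  by (auto intro!: derivative_eq_intros ln_p_sigma_derivatives(2)[OF assms])

text \<open>By the definition of \<open>pi_sigma\<close>, a gradient step of size one on
  \<open>d_sigma\<close> moves \<open>x\<close> to \<open>pi_sigma \<mu> \<sigma> x\<close>.\<close>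

lemma d_sigma_has_derivative:
  assumes "\<sigma> > 0"
  shows "(d_sigma \<mu> \<sigma> has_derivative (\<lambda>h. (x - pi_sigma \<mu> \<sigma> x) \<bullet> h)) (at x)"
proof -
  have "(d_sigma \<mu> \<sigma> has_derivative
      (\<lambda>h. - \<sigma>\<^sup>2 * (grad (\<lambda>z. ln (p_sigma \<mu> \<sigma> z)) x \<bullet> h))) (at x)"
    unfolding d_sigma_def [abs_def]
    by (rule has_derivative_mult_right[OF ln_p_sigma_derivatives(1)[OF assms]])
  then show ?thesis by (simp add: pi_sigma_def)
qed

text \<open>Chain rule. Leaving \<open>P_sigma\<close> on the test vector makes the operator bounds
  directly applicable; \<open>h\<close> will be the gradient itself and the normal offset.\<close>

lemma inner_grad_F_sigma:
  assumes \<sigma>: "\<sigma> > 0" and f: "C1_on UNIV f"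
  shows "grad (F_sigma \<mu> f \<sigma> \<eta>) x \<bullet> h =
    grad f (pi_sigma \<mu> \<sigma> x) \<bullet> P_sigma \<mu> \<sigma> x h + \<eta> * ((x - pi_sigma \<mu> \<sigma> x) \<bullet> h)"
proof -
  have "((\<lambda>x. f (pi_sigma \<mu> \<sigma> x)) has_derivative
      (\<lambda>h. grad f (pi_sigma \<mu> \<sigma> x) \<bullet> P_sigma \<mu> \<sigma> x h)) (at x)"
    by (rule has_derivative_compose[OF pi_sigma_has_derivative[OF \<sigma>] C1_on_UNIV_grad(1)[OF f]])
  then have "(F_sigma \<mu> f \<sigma> \<eta> has_derivative (\<lambda>h. grad f (pi_sigma \<mu> \<sigma> x) \<bullet> P_sigma \<mu> \<sigma> x h
      + \<eta> * ((x - pi_sigma \<mu> \<sigma> x) \<bullet> h))) (at x)"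
    unfolding F_sigma_def [abs_def]
    by (auto intro!: derivative_eq_intros d_sigma_has_derivative[OF \<sigma>])
  from inner_grad[OF this] show ?thesis .
qed

end

section \<open>Invariance of the tube\<close>

theorem theorem8:
  fixes M :: "'a::euclidean_space set" and \<mu> :: "'a measure" and f :: "'a \<Rightarrow> real"
    and \<eta> \<tau> \<sigma> \<epsilon> C :: real and \<gamma> :: "nat \<Rightarrow> real" and x :: "nat \<Rightarrow> 'a"
  assumes M: "compact M" "C2_submanifold M" "reach M > 0"
    and \<mu>: "prob_space \<mu>" "sets \<mu> = sets borel" "AE y in \<mu>. y \<in> M"
    and f: "C1_on UNIV f"
    and C_def: "C = (SUP z\<in>tube M (reach M). norm (grad f z))"
    and \<eta>: "\<eta> > 0"
    and \<tau>: "0 < \<tau>" "\<tau> < reach M / 2"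
    and \<sigma>: "\<sigma> > 0"
    and \<epsilon>: "0 < \<epsilon>" "\<epsilon> \<le> \<eta> * \<tau> / (2 * (C + \<eta>))"
    and approx_pi: "\<forall>z\<in>tube M \<tau>. norm (pi_sigma \<mu> \<sigma> z - proj M z) < \<epsilon>"
    and approx_P: "\<forall>z\<in>tube M \<tau>. onorm (\<lambda>h. P_sigma \<mu> \<sigma> z h - P0 M z h) < \<epsilon>"
    and \<gamma>: "\<forall>k. 0 \<le> \<gamma> k \<and> \<gamma> k \<le> gamma_tubular C \<epsilon> \<tau> \<eta>"
    and x0: "x 0 \<in> tube M \<tau>"
    and iter: "\<forall>k. x (Suc k) = x k - \<gamma> k *\<^sub>R grad (F_sigma \<mu> f \<sigma> \<eta>) (x k)"
  shows "\<forall>k. x k \<in> tube M \<tau>"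
proof -
  \<comment> \<open>Room above \<open>2 * \<tau>\<close> lets the Lipschitz estimate be used with
    \<open>r = \<tau>\<close> and \<open>s = 2 * \<tau>\<close>, giving the constant 2.\<close>
  obtain t where t: "2 * \<tau> < t" "t < reach M" using \<tau>(2) dense[of "2 * \<tau>" "reach M"] by auto
  have diffeo: "normal_map_diffeo M t" and diffeo\<tau>: "normal_map_diffeo M \<tau>"
    using t \<tau> by (auto intro: normal_map_diffeo_below_reach[OF M(1)])
  \<comment> \<open>The real supremum \<open>C\<close> bounds the gradient only once the set is
    known to be bounded: \<open>grad f\<close> is continuous and the tube relatively
    compact.\<close>
  have bdd: "bdd_above ((\<lambda>z. norm (grad f z)) ` tube M (reach M))"
  proof -
    have "compact (closure (tube M (reach M)))"
      using bounded_tube[OF M(1)] by simp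
    then have "bounded (grad f ` closure (tube M (reach M)))"
      using C1_on_UNIV_grad(2)[OF f]
      by (meson compact_continuous_image compact_imp_bounded continuous_on_subset top_greatest)
    then show ?thesis
      unfolding bounded_iff bdd_above_def using closure_subset by fastforce
  qed
  have grad_le: "norm (grad f z) \<le> C" if "z \<in> tube M (reach M)" for z
    unfolding C_def using that bdd by (rule cSUP_upper)
  have "tube M \<tau> \<subseteq> tube M (reach M)"
    using \<tau> normal_bundle_mono[of \<tau> "reach M" M] by (auto simp: tube_def)
  then have "0 \<le> C" using grad_le x0 norm_ge_zero order.trans by blast
  have C\<eta>: "(C + \<eta>) * \<epsilon> \<le> \<eta> * \<tau> / 2" using \<epsilon>(2) \<open>0 \<le> C\<close> \<eta> by (simp add: field_simps)
  have "\<eta> * \<epsilon> \<le> (C + \<eta>) * \<epsilon>" using \<open>0 \<le> C\<close> \<epsilon> by (simp add: mult_right_mono)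
  with C\<eta> have "\<eta> * \<epsilon> \<le> \<eta> * (\<tau> / 2)" by simp
  then have \<epsilon>_le: "\<epsilon> \<le> \<tau> / 2" using \<eta> by simp
  \<comment> \<open>\<open>N\<close> will bound the gradient norm, and the first entry of the
    minimum in \<open>gamma_tubular\<close> is \<open>1 / (2 * N)\<close>; \<open>\<delta>\<close>
    below is the numerator of the second entry.\<close>
  define N where "N = C * (\<epsilon> + 2) + 2 * \<eta> * \<tau>"
  have "N > 0" unfolding N_def using \<open>0 \<le> C\<close> \<eta> \<tau>(1) \<epsilon>(1) by (intro add_nonneg_pos) auto
  define \<delta> where "\<delta> = 1/4 * \<eta> * \<tau> - 1/2 * (C + \<eta>) * \<epsilon>"
  have "\<delta> \<ge> 0" unfolding \<delta>_def using C\<eta> by (simp add: mult.commute)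

  have step: "z - c *\<^sub>R grad (F_sigma \<mu> f \<sigma> \<eta>) z \<in> tube M \<tau>"
    if z: "z \<in> tube M \<tau>" and c: "0 \<le> c" "c \<le> gamma_tubular C \<epsilon> \<tau> \<eta>" for z c
  proof -
    define p v g where pvg: "p = proj M z" "v = z - p" "g = grad (F_sigma \<mu> f \<sigma> \<eta>) z"
    have p: "p \<in> M" "norm v < \<tau>"
      using tube_proj[OF M(1) diffeo\<tau> z] by (auto simp: pvg normal_bundle_def)
    have zt: "z \<in> tube M t" using z t \<tau> normal_bundle_mono[of \<tau> t M] by (auto simp: tube_def)
    have pi: "norm (pi_sigma \<mu> \<sigma> z - p) < \<epsilon>" using approx_pi z by (simp add: pvg)
    \<comment> \<open>\<open>pi_sigma\<close> may leave the smaller tube, but stays in the one of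
      full reach, where \<open>C\<close> controls \<open>grad f\<close>.\<close>
    have "dist (pi_sigma \<mu> \<sigma> z) p < reach M"
      using pi \<epsilon>_le \<tau> by (simp add: dist_norm)
    then have "pi_sigma \<mu> \<sigma> z \<in> tube M (reach M)" using p(1) mem_tube_iff[OF M(1)] by blast
    then have gf: "norm (grad f (pi_sigma \<mu> \<sigma> z)) \<le> C" by (rule grad_le)
    have P0: "(proj M has_derivative P0 M z) (at z)"
      by (rule proj_has_derivative_P0[OF M(1) diffeo zt])
    have P0_le: "norm (P0 M z h) \<le> 2 * norm h" for h
    proof (rule has_derivative_norm_le_of_Lipschitz[OF P0 open_tube[OF M(1)] z])
      fix y assume "y \<in> tube M \<tau>"
      then have "(2 * \<tau> - \<tau>) * norm (proj M y - proj M z) \<le> 2 * \<tau> * norm (y - z)"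
        using \<tau> by (intro proj_Lipschitz[OF M(1) diffeo _ t(1)] z) auto
      then have "\<tau> * norm (proj M y - proj M z) \<le> \<tau> * (2 * norm (y - z))" by simp
      then show "norm (proj M y - proj M z) \<le> 2 * norm (y - z)" using \<tau>(1) by simp
    qed
    have PP: "norm (P_sigma \<mu> \<sigma> z h - P0 M z h) \<le> \<epsilon> * norm h" for h
    proof -
      have "bounded_linear (\<lambda>h. P_sigma \<mu> \<sigma> z h - P0 M z h)"
        using pi_sigma_has_derivative[OF M(1) \<mu> \<sigma>] P0
        by (intro bounded_linear_sub) (auto intro: has_derivative_bounded_linear)
      from onorm[OF this, of h] show ?thesis
        using approx_P z mult_right_mono[of "onorm (\<lambda>h. P_sigma \<mu> \<sigma> z h - P0 M z h)" \<epsilon> "norm h"]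
        by fastforce
    qed
    have g_inner: "g \<bullet> h = grad f (pi_sigma \<mu> \<sigma> z) \<bullet> P_sigma \<mu> \<sigma> z h + \<eta> * ((z - pi_sigma \<mu> \<sigma> z) \<bullet> h)" for h
      unfolding pvg by (rule inner_grad_F_sigma[OF M(1) \<mu> \<sigma> f])
    have f_inner: "\<bar>grad f (pi_sigma \<mu> \<sigma> z) \<bullet> u\<bar> \<le> C * B" if "norm u \<le> B" for u B
    proof -
      have "\<bar>grad f (pi_sigma \<mu> \<sigma> z) \<bullet> u\<bar> \<le> norm (grad f (pi_sigma \<mu> \<sigma> z)) * norm u"
        by (rule Cauchy_Schwarz_ineq2)
      also have "\<dots> \<le> C * B" using gf that \<open>0 \<le> C\<close> by (intro mult_mono) auto
      finally show ?thesis .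
    qed
    \<comment> \<open>Test the gradient formula with \<open>h = g\<close>, then cancel one factor
      \<open>norm g\<close>.\<close>
    have g_le: "norm g \<le> N"
    proof -
      have "norm (P_sigma \<mu> \<sigma> z g) \<le> (\<epsilon> + 2) * norm g"
        using PP[of g] P0_le[of g] norm_triangle_sub[of "P_sigma \<mu> \<sigma> z g" "P0 M z g"]
        by (simp add: distrib_right)
      from f_inner[OF this]
      have 1: "grad f (pi_sigma \<mu> \<sigma> z) \<bullet> P_sigma \<mu> \<sigma> z g \<le> C * (\<epsilon> + 2) * norm g" by simp
      have "norm (z - pi_sigma \<mu> \<sigma> z) \<le> norm v + norm (pi_sigma \<mu> \<sigma> z - p)"
        using norm_triangle_ineq4[of v "pi_sigma \<mu> \<sigma> z - p"] by (simp add: pvg)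
      then have "norm (z - pi_sigma \<mu> \<sigma> z) \<le> 2 * \<tau>" using p(2) pi \<epsilon>_le \<tau>(1) by simp
      then have "(z - pi_sigma \<mu> \<sigma> z) \<bullet> g \<le> 2 * \<tau> * norm g"
        using norm_cauchy_schwarz[of "z - pi_sigma \<mu> \<sigma> z" g]
          mult_right_mono[of "norm (z - pi_sigma \<mu> \<sigma> z)" "2 * \<tau>" "norm g"] by simp
      then have "\<eta> * ((z - pi_sigma \<mu> \<sigma> z) \<bullet> g) \<le> \<eta> * (2 * \<tau> * norm g)"
        using \<eta> by (intro mult_left_mono) auto
      with 1 have "g \<bullet> g \<le> N * norm g"
        unfolding g_inner[of g] N_def by (simp add: algebra_simps)
      then have "norm g * norm g \<le> N * norm g"
        by (simp add: power2_norm_eq_inner[symmetric] power2_eq_square)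
      then show ?thesis using \<open>N > 0\<close> by (cases "g = 0") auto
    qed
    have c1: "c * N \<le> \<tau> / 2"
    proof -
      have "c \<le> \<tau> * (1 / (2 * N))"
        using c(2) \<tau>(1) unfolding gamma_tubular_def N_def
        by (meson min.cobounded1 mult_left_mono order.trans less_imp_le)
      then show ?thesis using \<open>N > 0\<close> by (simp add: field_simps)
    qed
    show ?thesis
    proof (cases "norm v < \<tau> / 2")
      case True
      have "norm (c *\<^sub>R g) \<le> c * N" using c(1) g_le by (simp add: mult_left_mono)
      then have "norm (v - c *\<^sub>R g) < \<tau>"
        using True c1 norm_triangle_ineq4[of v "c *\<^sub>R g"] by linarith
      then have "dist (z - c *\<^sub>R g) p < \<tau>" by (simp add: dist_norm pvg algebra_simps)
      then show ?thesis using p(1) mem_tube_iff[OF M(1)] pvg by blast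
    next
      case False
      \<comment> \<open>Test with \<open>h = v\<close>: as \<open>P0\<close> annihilates
        \<open>v\<close>, the \<open>f\<close> term is only of order
        \<open>\<epsilon> * norm v\<close>. Since \<open>norm v \<ge> \<tau> / 2\<close>, the
        remaining bracket is at least \<open>\<eta> * \<tau> / 2 - (C + \<eta>) * \<epsilon> = 2 *
        \<delta>\<close>.\<close>
      have inner_ge: "g \<bullet> v \<ge> \<tau> * \<delta>"
      proof -
        have "norm (P_sigma \<mu> \<sigma> z v) \<le> \<epsilon> * norm v"
          using PP[of v] P0_normal_eq_0[OF M(1) diffeo zt] by (simp add: pvg)
        from f_inner[OF this]
        have 1: "grad f (pi_sigma \<mu> \<sigma> z) \<bullet> P_sigma \<mu> \<sigma> z v \<ge> - (C * (\<epsilon> * norm v))" by simp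
        have "(z - pi_sigma \<mu> \<sigma> z) \<bullet> v = norm v * norm v - (pi_sigma \<mu> \<sigma> z - p) \<bullet> v"
          by (simp add: pvg power2_norm_eq_inner[symmetric] power2_eq_square[symmetric])
            (simp add: power2_norm_eq_inner inner_diff)
        moreover have "(pi_sigma \<mu> \<sigma> z - p) \<bullet> v \<le> \<epsilon> * norm v"
          using norm_cauchy_schwarz[of "pi_sigma \<mu> \<sigma> z - p" v] pi
            mult_right_mono[of "norm (pi_sigma \<mu> \<sigma> z - p)" \<epsilon> "norm v"] by simp
        ultimately have "\<eta> * ((z - pi_sigma \<mu> \<sigma> z) \<bullet> v) \<ge> \<eta> * (norm v * norm v - \<epsilon> * norm v)"
          using \<eta> by simp
        with 1 have "g \<bullet> v \<ge> norm v * (\<eta> * norm v - (C + \<eta>) * \<epsilon>)"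
          unfolding g_inner[of v] by (simp add: algebra_simps)
        moreover have "norm v * (\<eta> * norm v - (C + \<eta>) * \<epsilon>) \<ge> (\<tau> / 2) * (2 * \<delta>)"
        proof (rule mult_mono)
          have "\<eta> * (\<tau> / 2) \<le> \<eta> * norm v" using False \<eta> by (intro mult_left_mono) auto
          then show "2 * \<delta> \<le> \<eta> * norm v - (C + \<eta>) * \<epsilon>" by (simp add: \<delta>_def)
        qed (use False \<open>\<delta> \<ge> 0\<close> in auto)
        ultimately show ?thesis by simp
      qed
      have c2: "c * (norm g)\<^sup>2 \<le> \<tau> * \<delta>"
      proof -
        \<comment> \<open>\<open>K\<close> exceeds \<open>N\<close> by
          \<open>2 * C + \<eta> * \<tau>\<close>, so the second entry of the minimum leaves slack;
          even the factor 4 in its denominator is given away.\<close>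
        define K where "K = C * (\<epsilon> + 4) + 3 * \<eta> * \<tau>"
        have "N \<le> K" using \<open>0 \<le> C\<close> \<eta> \<tau>(1) by (simp add: N_def K_def algebra_simps)
        then have K: "K > 0" "(norm g)\<^sup>2 \<le> K\<^sup>2"
          using \<open>N > 0\<close> g_le by (auto intro!: power_mono)
        have "c \<le> \<tau> * (\<delta> / (4 * K\<^sup>2))"
          using c(2) \<tau>(1) unfolding gamma_tubular_def \<delta>_def K_def
          by (meson min.cobounded2 mult_left_mono order.trans less_imp_le)
        then have "c * (norm g)\<^sup>2 \<le> \<tau> * (\<delta> / (4 * K\<^sup>2)) * K\<^sup>2"
          using K c(1) \<tau>(1) \<open>\<delta> \<ge> 0\<close> by (intro mult_mono) auto
        also have "\<dots> = \<tau> * \<delta> / 4" using K(1) by simp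
        also have "\<dots> \<le> \<tau> * \<delta>" using \<tau>(1) \<open>\<delta> \<ge> 0\<close> by simp
        finally show ?thesis .
      qed
      have "0 \<le> \<tau> * \<delta>" using \<tau>(1) \<open>\<delta> \<ge> 0\<close> by simp
      \<comment> \<open>This is exactly what makes the quadratic term in the expansion of
        \<open>norm (v - c *\<^sub>R g)\<close> squared no larger than the linear gain.\<close>
      then have "c * (norm g)\<^sup>2 \<le> 2 * (g \<bullet> v)" using c2 inner_ge by simp
      then have "c * (c * (norm g)\<^sup>2) \<le> c * (2 * (g \<bullet> v))" using c(1) by (rule mult_left_mono)
      moreover have "(norm (v - c *\<^sub>R g))\<^sup>2 = (norm v)\<^sup>2 - c * (2 * (g \<bullet> v)) + c * (c * (norm g)\<^sup>2)"
        by (simp add: power2_norm_eq_inner inner_diff inner_commute algebra_simps)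
      ultimately have "(norm (v - c *\<^sub>R g))\<^sup>2 \<le> (norm v)\<^sup>2" by simp
      then have "norm (v - c *\<^sub>R g) \<le> norm v" by (rule power2_le_imp_le) simp
      \<comment> \<open>The old foot point \<open>p\<close> need not be nearest to the new iterate;
        its distance below \<open>\<tau>\<close> already places the iterate in the tube.\<close>
      then have "dist (z - c *\<^sub>R g) p < \<tau>"
        using p(2) by (simp add: dist_norm pvg algebra_simps)
      then show ?thesis using p(1) mem_tube_iff[OF M(1)] pvg by blast
    qed
  qed
  show ?thesis
  proof
    fix k show "x k \<in> tube M \<tau>"
      by (induction k) (use x0 step iter \<gamma> in auto)
  qed
qed

end
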